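(* In the payment network creation game with $n$ players, betweenness weight $b\ge 0$ and closeness weight $c>0$ with $c+b<\frac{1}{n^2}$, the price of anarchy is $\mathrm{PoA}=\mathcal{O}(1)$; i.e., there is an absolute constant $C$ such that $\mathrm{PoA}\le C$ for all $n$, $b$, $c$ satisfying these conditions.
   Context: Payment network creation game. There are $n\ge 2$ players $[n]=\{0,1,\dots,n-1\}$. A strategy of player $u$ is a set $s_u\subseteq [n]\setminus\{u\}$ (the players to whom $u$ opens a channel). A strategy combination is $s=(s_0,\dots,s_{n-1})$, and $G[s]$ is the undirected simple graph on $[n]$ in which $u,v$ are adjacent iff $v\in s_u$ or $u\in s_v$. With weights $b\ge 0$ and $c>0$, the cost of $u$ is $$\mathrm{cost}_u(s)=|s_u|+b\cdot \mathrm{betweenness}_u(s)+c\cdot \mathrm{closeness}_u(s),$$ $$\mathrm{betweenness}_u(s)=(n-1)(n-2)-\sum_{\substack{(i,j)\in[n]^2:\ i\ne j,\ i\neq u,\ j\ne u,\\ m(i,j)>0}}\frac{m_u(i,j)}{m(i,j)},\qquad \mathrm{closeness}_u(s)=\sum_{v\in[n]\setminus\{u\}}\bigl(d_{G[s]}(u,v)-1\bigr).$$ The sum in the betweenness runs over ordered pairs; $m(i,j)$ is the number of shortest paths between $i$ and $j$ in $G[s]$ and $m_u(i,j)$ the number of those passing through $u$; $d_{G[s]}$ is graph distance, equal to $\infty$ between different components. The social cost is $\mathrm{cost}(s)=\sum_{u}\mathrm{cost}_u(s)$. A strategy combination is a Nash equilibrium if no player can strictly decrease her cost by unilaterally changing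 her strategy; equilibrium graphs are taken to be connected (a player's cost is infinite in a disconnected graph, and disconnected strategy combinations are not regarded as equilibria). With $S$ the set of all strategy combinations and $N$ the set of Nash equilibria, $\mathrm{PoA}=\dfrac{\max_{s\in N}\mathrm{cost}(s)}{\min_{s\in S}\mathrm{cost}(s)}$. *)

theory Defs
  imports "Graph_Theory.Graph_Theory"
begin

(* A strategy combination s maps each player u < n to the set of players to whom u opens a
   channel.  Extensionality (value undefined outside {..<n}) makes the set finite, with exactly
   one representative per n-tuple of strategies. *)
definition strategies :: "nat \<Rightarrow> nat \<Rightarrow> nat set set" where
  "strategies n u = Pow ({..<n} - {u})"

definition combinations :: "nat \<Rightarrow> (nat \<Rightarrow> nat set) set" where
  "combinations n = (\<Pi>\<^sub>E u\<in>{..<n}. strategies n u)"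

(* As usual in Graph_Theory, an undirected simple graph is a symmetric loop-free digraph whose
   arcs are pairs of vertices. *)
definition network :: "nat \<Rightarrow> (nat \<Rightarrow> nat set) \<Rightarrow> nat pair_pre_digraph" where
  "network n s = \<lparr> pverts = {..<n},
     parcs = {(u, v). u < n \<and> v < n \<and> u \<noteq> v \<and> (v \<in> s u \<or> u \<in> s v)} \<rparr>"

lemma pair_graph_network: "pair_graph (network n s)"
proof
  show "finite (parcs (network n s))"
    by (rule finite_subset[of _ "{..<n} \<times> {..<n}"]) (auto simp: network_def)
  show "symmetric (with_proj (network n s))"
    by (auto simp: symmetric_def arcs_ends_def arc_to_ends_def network_def intro!: symI)
qed (auto simp: network_def)

(* With unit weights this is the hop distance; it is \<infinity> between different components. *)
definition distance :: "nat \<Rightarrow> (nat \<Rightarrow> nat set) \<Rightarrow> nat \<Rightarrow> nat \<Rightarrow> ereal" where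
  "distance n s u v = wf_digraph.\<mu> (with_proj (network n s)) (\<lambda>_. 1) u v"

(* Arcs are pairs of vertices and each edge gives exactly one arc per direction, so arc walks
   from i to j correspond one-to-one to vertex walks from i to j. *)
definition shortest_paths ::
    "nat \<Rightarrow> (nat \<Rightarrow> nat set) \<Rightarrow> nat \<Rightarrow> nat \<Rightarrow> (nat \<times> nat) awalk set" where
  "shortest_paths n s i j =
     {p. pre_digraph.awalk (with_proj (network n s)) i p j \<and>
         ereal (real (length p)) = distance n s i j}"

definition num_paths :: "nat \<Rightarrow> (nat \<Rightarrow> nat set) \<Rightarrow> nat \<Rightarrow> nat \<Rightarrow> nat" where
  "num_paths n s i j = card (shortest_paths n s i j)"

definition num_paths_through ::
    "nat \<Rightarrow> (nat \<Rightarrow> nat set) \<Rightarrow> nat \<Rightarrow> nat \<Rightarrow> nat \<Rightarrow> nat" where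
  "num_paths_through n s u i j =
     card {p \<in> shortest_paths n s i j.
             u \<in> set (pre_digraph.awalk_verts (with_proj (network n s)) i p)}"

definition betweenness :: "nat \<Rightarrow> (nat \<Rightarrow> nat set) \<Rightarrow> nat \<Rightarrow> real" where
  "betweenness n s u =
     (real n - 1) * (real n - 2) -
     (\<Sum>(i, j) \<in> {(i, j) \<in> {..<n} \<times> {..<n}.
                   i \<noteq> j \<and> i \<noteq> u \<and> j \<noteq> u \<and> num_paths n s i j > 0}.
        real (num_paths_through n s u i j) / real (num_paths n s i j))"

definition closeness :: "nat \<Rightarrow> (nat \<Rightarrow> nat set) \<Rightarrow> nat \<Rightarrow> ereal" where
  "closeness n s u = (\<Sum>v\<in>{..<n} - {u}. distance n s u v - 1)"

definition cost :: "nat \<Rightarrow> real \<Rightarrow> real \<Rightarrow> (nat \<Rightarrow> nat set) \<Rightarrow> nat \<Rightarrow> ereal" where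
  "cost n b c s u =
     ereal (real (card (s u))) + ereal (b * betweenness n s u) + ereal c * closeness n s u"

definition social_cost :: "nat \<Rightarrow> real \<Rightarrow> real \<Rightarrow> (nat \<Rightarrow> nat set) \<Rightarrow> ereal" where
  "social_cost n b c s = (\<Sum>u<n. cost n b c s u)"

definition nash_equilibria :: "nat \<Rightarrow> real \<Rightarrow> real \<Rightarrow> (nat \<Rightarrow> nat set) set" where
  "nash_equilibria n b c =
     {s \<in> combinations n.
        Digraph_Component.connected (with_proj (network n s)) \<and>
        (\<forall>u<n. \<forall>t\<in>strategies n u. \<not> cost n b c (s(u := t)) u < cost n b c s u)}"

(* Both sets are finite.  Max is unspecified on the empty set, so a bound on the price of anarchy
   is only provable when equilibria exist. *)
definition price_of_anarchy :: "nat \<Rightarrow> real \<Rightarrow> real \<Rightarrow> ereal" where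
  "price_of_anarchy n b c =
     Max (social_cost n b c ` nash_equilibria n b c) /
     Min (social_cost n b c ` combinations n)"

end

theory Submission
  imports Defs
begin

text \<open>
  Since \<open>c + b < 1/n\<^sup>2\<close>, in a connected network the betweenness and closeness terms of a
  player together cost less than one channel. In an equilibrium no channel can therefore be dropped
  without disconnecting the network, so all channels lie on a fixed spanning tree and the social cost
  is at most \<open>2(n - 1) + n\<close>. Conversely every connected network needs at least
  \<open>n/2\<close> channels, because no player is isolated. The star whose centre pays for all channels is
  an equilibrium.
\<close>

section \<open>Spanning trees\<close>

text \<open>Breadth-first tree of \<open>R\<close> rooted at \<open>r\<close>: \<open>d v\<close> is
  the length of a shortest chain from \<open>r\<close> to \<open>v\<close>, and \<open>p v\<close>
  is the last vertex before \<open>v\<close> on such a chain, hence one layer closer to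
  \<open>r\<close>.\<close>

lemma rtrancl_parent:
  fixes r :: 'a
  obtains p :: "'a \<Rightarrow> 'a" and d :: "'a \<Rightarrow> nat"
  where "\<And>v. (r, v) \<in> R\<^sup>* \<Longrightarrow> v \<noteq> r \<Longrightarrow> (r, p v) \<in> R\<^sup>* \<and> (p v, v) \<in> R \<and> d (p v) < d v"
proof -
  define d where "d v = (LEAST k. (r, v) \<in> R ^^ k)" for v
  have "\<exists>w. (r, w) \<in> R\<^sup>* \<and> (w, v) \<in> R \<and> d w < d v" if reach: "(r, v) \<in> R\<^sup>*" and ne: "v \<noteq> r" for v
  proof -
    have "(r, v) \<in> R ^^ d v"
      unfolding d_def using reach by (metis LeastI_ex rtrancl_imp_relpow)
    then obtain j where j: "d v = Suc j"
      using ne by (cases "d v") auto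
    then obtain w where w: "(r, w) \<in> R ^^ j" "(w, v) \<in> R"
      using \<open>(r, v) \<in> R ^^ d v\<close> by auto
    have "d w \<le> j"
      unfolding d_def using w(1) by (rule Least_le)
    then show ?thesis
      using w j relpow_imp_rtrancl by (metis le_imp_less_Suc)
  qed
  then show thesis
    using that[of "\<lambda>v. SOME w. (r, w) \<in> R\<^sup>* \<and> (w, v) \<in> R \<and> d w < d v" d]
    by (metis (mono_tags, lifting) someI_ex)
qed

text \<open>Following parents strictly decreases \<open>d\<close>, so the descent can only stop at
  \<open>r\<close>. As \<open>R\<close> is arbitrary, a tree found in one network also certifies
  connectedness of any other network that keeps its arcs.\<close>

lemma rtrancl_via_parent:
  fixes d :: "'a \<Rightarrow> nat"
  assumes "\<And>v. v \<in> V \<Longrightarrow> v \<noteq> r \<Longrightarrow> p v \<in> V \<and> (p v, v) \<in> R \<and> d (p v) < d v"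
    and "v \<in> V"
  shows "(r, v) \<in> R\<^sup>*"
  using assms(2)
proof (induction "d v" arbitrary: v rule: less_induct)
  case less
  then show ?case
    using assms(1)[of v] by (cases "v = r") (auto intro: rtrancl_into_rtrancl)
qed

section \<open>Connectedness of networks\<close>

lemma network_simps [simp]:
  "pverts (network n s) = {..<n}"
  "(u, v) \<in> parcs (network n s) \<longleftrightarrow> u < n \<and> v < n \<and> u \<noteq> v \<and> (v \<in> s u \<or> u \<in> s v)"
  by (auto simp: network_def)

text \<open>Library reachability relates vertices only, while the reflexive closure relates every
  number to itself; the bounds on \<open>u\<close> and \<open>v\<close> reconcile the two.\<close>

lemma network_reachable_iff:
  assumes "u < n" "v < n"
  shows "u \<rightarrow>\<^sup>*\<^bsub>with_proj (network n s)\<^esub> v \<longleftrightarrow> (u, v) \<in> (parcs (network n s))\<^sup>*"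
proof -
  interpret pair_graph "network n s" by (rule pair_graph_network)
  show ?thesis using assms by (simp add: reachable_conv)
qed

lemma sym_network: "sym ((parcs (network n s))\<^sup>*)"
  by (rule sym_rtrancl) (auto intro!: symI)

text \<open>Arcs are symmetric, so any two players are joined by a walk through \<open>r\<close>,
  and the symmetrization inside the library notion of connectedness changes nothing.\<close>

lemma connected_network_iff:
  assumes "r < n"
  shows "Digraph_Component.connected (with_proj (network n s)) \<longleftrightarrow>
    (\<forall>v<n. (r, v) \<in> (parcs (network n s))\<^sup>*)"
proof -
  interpret pair_graph "network n s" by (rule pair_graph_network)
  have "Digraph_Component.connected (with_proj (network n s)) \<longleftrightarrow>
      (\<forall>u<n. \<forall>v<n. (u, v) \<in> (parcs (network n s))\<^sup>*)"
    using assms reachable_mk_symmetric_eq[OF sym_arcs]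
    by (auto simp: Digraph_Component.connected_def strongly_connected_def network_reachable_iff)
  also have "\<dots> \<longleftrightarrow> (\<forall>v<n. (r, v) \<in> (parcs (network n s))\<^sup>*)"
    using assms sym_network[of n s] by (meson rtrancl_trans symD)
  finally show ?thesis .
qed

lemma connected_obtain_parent:
  assumes "Digraph_Component.connected (with_proj (network n s))" "r < n"
  obtains p and d :: "nat \<Rightarrow> nat"
  where "\<And>v. v < n \<Longrightarrow> v \<noteq> r \<Longrightarrow> (p v, v) \<in> parcs (network n s) \<and> d (p v) < d v"
proof -
  obtain p and d :: "nat \<Rightarrow> nat" where
    "\<And>v. (r, v) \<in> (parcs (network n s))\<^sup>* \<Longrightarrow> v \<noteq> r \<Longrightarrow>
      (r, p v) \<in> (parcs (network n s))\<^sup>* \<and> (p v, v) \<in> parcs (network n s) \<and> d (p v) < d v"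
    by (rule rtrancl_parent[of r "parcs (network n s)"]) blast
  then show thesis
    using that[of p d] assms by (simp only: connected_network_iff[OF assms(2)]) blast
qed

section \<open>Costs\<close>

text \<open>A minimum is attained by a simple path, which has fewer arcs than there are vertices,
  and at least one arc because its ends differ.\<close>

lemma distance_connected:
  assumes "Digraph_Component.connected (with_proj (network n s))" "u < n" "v < n" "u \<noteq> v"
  shows "\<exists>k. distance n s u v = ereal (real k) \<and> 1 \<le> k \<and> k < n"
proof -
  interpret pair_graph "network n s" by (rule pair_graph_network)
  have len: "awalk_cost (\<lambda>_. 1) p = real (length p)" for p :: "(nat \<times> nat) list"
    by (induction p) auto
  have "u \<rightarrow>\<^sup>*\<^bsub>with_proj (network n s)\<^esub> v"
    using assms by (auto simp: network_reachable_iff connected_network_iff)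
  then obtain p where p: "apath u p v" "\<mu> (\<lambda>_. 1) u v = ereal (awalk_cost (\<lambda>_. 1) p)"
    using min_cost_awalk[of u v "\<lambda>_. 1"] by auto
  have "p \<noteq> []"
    using p(1) assms(4) by (auto simp: apath_def awalk_Nil_iff)
  moreover have "length p < n"
    using length_apath_less[OF p(1)] by simp
  ultimately show ?thesis
    using p(2) by (intro exI[of _ "length p"]) (auto simp: distance_def len Suc_le_eq)
qed

lemma distance_unreachable:
  assumes "u < n" "v < n" "(u, v) \<notin> (parcs (network n s))\<^sup>*"
  shows "distance n s u v = \<infinity>"
proof -
  interpret pair_graph "network n s" by (rule pair_graph_network)
  show ?thesis
    unfolding distance_def using assms by (intro shortest_path_inf) (simp add: network_reachable_iff)
qed

text \<open>Each of the \<open>n - 1\<close> summands lies between 0 and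
  \<open>n - 2\<close>.\<close>

lemma closeness_connected:
  assumes "Digraph_Component.connected (with_proj (network n s))" "u < n"
  shows "\<exists>x. closeness n s u = ereal x \<and> 0 \<le> x \<and> x \<le> (real n - 1) * (real n - 2)"
proof -
  have "\<forall>v\<in>{..<n} - {u}. \<exists>k. distance n s u v = ereal (real k) \<and> 1 \<le> k \<and> k < n"
    using assms distance_connected by auto
  then obtain k where
    k: "\<And>v. v \<in> {..<n} - {u} \<Longrightarrow> distance n s u v = ereal (real (k v)) \<and> 1 \<le> k v \<and> k v < n"
    by metis
  define x where "x = (\<Sum>v\<in>{..<n} - {u}. real (k v) - 1)"
  have "closeness n s u = (\<Sum>v\<in>{..<n} - {u}. ereal (real (k v) - 1))"
    unfolding closeness_def by (intro sum.cong) (auto simp: k one_ereal_def)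
  then have "closeness n s u = ereal x"
    by (simp add: x_def)
  moreover have "0 \<le> x"
    unfolding x_def using k by (intro sum_nonneg) force
  moreover have "x \<le> real (card ({..<n} - {u})) * (real n - 2)"
    unfolding x_def using k by (intro sum_bounded_above) (force simp: of_nat_less_iff)
  ultimately show ?thesis
    using assms(2) by (auto simp: of_nat_diff)
qed

text \<open>The sum has at most \<open>(n - 1) * (n - 2)\<close> terms, each a fraction between 0
  and 1.\<close>

lemma betweenness_bounds:
  assumes "u < n"
  shows "0 \<le> betweenness n s u" "betweenness n s u \<le> (real n - 1) * (real n - 2)"
proof -
  define A where "A = {(i, j) \<in> {..<n} \<times> {..<n}. i \<noteq> j \<and> i \<noteq> u \<and> j \<noteq> u \<and> num_paths n s i j > 0}"
  define f where "f = (\<lambda>(i, j). real (num_paths_through n s u i j) / real (num_paths n s i j))"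
  have B: "betweenness n s u = (real n - 1) * (real n - 2) - sum f A"
    by (simp add: betweenness_def A_def f_def)
  have f: "0 \<le> f x \<and> f x \<le> 1" if "x \<in> A" for x
  proof -
    obtain i j where x: "x = (i, j)" by fastforce
    then have pos: "num_paths n s i j > 0"
      using that by (simp add: A_def)
    \<comment> \<open>An infinite set would have cardinality 0.\<close>
    then have "finite (shortest_paths n s i j)"
      by (simp add: num_paths_def card_gt_0_iff)
    then have "num_paths_through n s u i j \<le> num_paths n s i j"
      unfolding num_paths_def num_paths_through_def by (intro card_mono) auto
    then show ?thesis
      using pos by (simp add: f_def x)
  qed
  show "betweenness n s u \<le> (real n - 1) * (real n - 2)"
    unfolding B using sum_nonneg[of A f] f by simp
  \<comment> \<open>There are \<open>n - 1\<close> choices for \<open>i\<close> and then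
    \<open>n - 2\<close> for \<open>j\<close>.\<close>
  have "A \<subseteq> (SIGMA i:{..<n} - {u}. {..<n} - {u, i})"
    by (auto simp: A_def)
  then have "card A \<le> card (SIGMA i:{..<n} - {u}. {..<n} - {u, i})"
    by (intro card_mono) auto
  also have "\<dots> = (\<Sum>i\<in>{..<n} - {u}. n - 2)"
    using assms by (subst card_SigmaI) (auto intro!: sum.cong simp: card_Diff_subset)
  finally have cardA: "card A \<le> (n - 1) * (n - 2)"
    using assms by simp
  have "sum f A \<le> real (card A)"
    using sum_bounded_above[of A f 1] f by simp
  also have "\<dots> \<le> real ((n - 1) * (n - 2))"
    using cardA by (simp only: of_nat_le_iff)
  \<comment> \<open>For \<open>n = 1\<close> the natural subtraction \<open>n - 2\<close> truncates,
    but the other factor is 0 on both sides.\<close>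
  also have "\<dots> = (real n - 1) * (real n - 2)"
    using assms by (cases "n = 1") (auto simp: of_nat_diff)
  finally show "0 \<le> betweenness n s u"
    unfolding B by simp
qed

text \<open>The betweenness and closeness terms add up to at most
  \<open>(c + b) * (n - 1) * (n - 2) < 1\<close>, so in connected networks a player's costs with
  different numbers of channels are ordered by these numbers.\<close>

lemma cost_connected:
  assumes "Digraph_Component.connected (with_proj (network n s))" "u < n"
    and "b \<ge> 0" "c > 0" "c + b < 1 / (real n)\<^sup>2"
  shows "ereal (card (s u)) \<le> cost n b c s u" "cost n b c s u < ereal (card (s u) + 1)"
proof -
  define N where "N = (real n - 1) * (real n - 2)"
  obtain x where x: "closeness n s u = ereal x" "0 \<le> x" "x \<le> N"
    using closeness_connected[OF assms(1,2)] N_def by auto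
  define y where "y = betweenness n s u"
  have y: "0 \<le> y" "y \<le> N"
    using betweenness_bounds[OF assms(2)] by (auto simp: y_def N_def)
  have cost: "cost n b c s u = ereal (card (s u) + (b * y + c * x))"
    by (simp add: cost_def x y_def)
  have "b * y + c * x \<le> b * N + c * N"
    using assms(3,4) x y by (intro add_mono mult_left_mono) auto
  also have "\<dots> = (c + b) * N"
    by (simp add: algebra_simps)
  also have "\<dots> \<le> (c + b) * (real n)\<^sup>2"
    using assms(2-4) by (intro mult_left_mono) (auto simp: N_def power2_eq_square algebra_simps)
  also have "\<dots> < 1"
    using assms(2,5) by (simp add: field_simps)
  finally show "cost n b c s u < ereal (card (s u) + 1)"
    by (simp add: cost)
  show "ereal (card (s u)) \<le> cost n b c s u"
    using assms(3,4) x y by (simp add: cost)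
qed

text \<open>Every player, in whichever component, misses some other player, and one infinite
  distance makes the whole sum infinite. Hence disconnecting deviations never pay.\<close>

lemma cost_disconnected:
  assumes "\<not> Digraph_Component.connected (with_proj (network n s))" "u < n" "c > 0"
  shows "cost n b c s u = \<infinity>"
proof -
  obtain v where v: "v < n" "(u, v) \<notin> (parcs (network n s))\<^sup>*"
    using assms by (auto simp: connected_network_iff[OF assms(2)])
  then have "distance n s u v - 1 = \<infinity>"
    using distance_unreachable[OF assms(2)] by simp
  moreover have "v \<noteq> u"
    using v by auto
  ultimately have "closeness n s u = \<infinity>"
    unfolding closeness_def sum_Pinfty using v by auto
  then show ?thesis
    using assms(3) by (simp add: cost_def)
qed

section \<open>Social cost\<close>

text \<open>No player is isolated, so each one opens or receives a channel. The players who open one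
  and the players who receive one each number at most the total of channels.\<close>

lemma connected_channels_ge:
  assumes "Digraph_Component.connected (with_proj (network n s))" "n \<ge> 2" "s \<in> combinations n"
  shows "n \<le> 2 * (\<Sum>u<n. card (s u))"
proof -
  have fin: "finite (s u)" if "u < n" for u
    using assms(3) that finite_subset[of "s u" "{..<n} - {u}"]
    by (auto simp: combinations_def strategies_def PiE_iff)
  have "v \<in> {u. u < n \<and> s u \<noteq> {}} \<union> (\<Union>u<n. s u)" if v: "v < n" for v
  proof -
    \<comment> \<open>With the root placed away from \<open>v\<close>, the arc from the parent of
      \<open>v\<close> is an edge at \<open>v\<close>.\<close>
    obtain r where r: "r < n" "v \<noteq> r"
      using assms(2) by (metis less_le_trans one_less_numeral_iff pos2 semiring_norm(76) zero_neq_one)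
    obtain p and d :: "nat \<Rightarrow> nat" where
      "\<And>v. v < n \<Longrightarrow> v \<noteq> r \<Longrightarrow> (p v, v) \<in> parcs (network n s) \<and> d (p v) < d v"
      using connected_obtain_parent[OF assms(1) r(1)] by blast
    then have "(p v, v) \<in> parcs (network n s)"
      using v r by auto
    then show ?thesis
      by auto
  qed
  then have "card {..<n} \<le> card ({u. u < n \<and> s u \<noteq> {}} \<union> (\<Union>u<n. s u))"
    using fin by (intro card_mono) auto
  also have "\<dots> \<le> card {u. u < n \<and> s u \<noteq> {}} + card (\<Union>u<n. s u)"
    by (rule card_Un_le)
  also have "card (\<Union>u<n. s u) \<le> (\<Sum>u<n. card (s u))"
    by (intro card_UN_le) simp
  also have "card {u. u < n \<and> s u \<noteq> {}} = (\<Sum>u<n. if s u \<noteq> {} then 1 else 0)"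
    by (simp add: sum.If_cases Int_def conj_commute)
  also have "\<dots> \<le> (\<Sum>u<n. card (s u))"
    using fin by (intro sum_mono) (auto simp: Suc_le_eq card_gt_0_iff)
  finally show ?thesis
    by simp
qed

lemma social_cost_ge:
  assumes "s \<in> combinations n" "n \<ge> 2" "b \<ge> 0" "c > 0" "c + b < 1 / (real n)\<^sup>2"
  shows "ereal (n / 2) \<le> social_cost n b c s"
proof (cases "Digraph_Component.connected (with_proj (network n s))")
  case True
  have "real n \<le> real (2 * (\<Sum>u<n. card (s u)))"
    using connected_channels_ge[OF True assms(2,1)] by (simp only: of_nat_le_iff)
  then have "ereal (n / 2) \<le> ereal (\<Sum>u<n. real (card (s u)))"
    by simp
  also have "\<dots> = (\<Sum>u<n. ereal (card (s u)))"
    by simp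
  also have "\<dots> \<le> social_cost n b c s"
    unfolding social_cost_def using cost_connected(1)[OF True] assms by (intro sum_mono) auto
  finally show ?thesis .
next
  case False
  have "cost n b c s 0 = \<infinity>"
    using assms(2,4) cost_disconnected[OF False] by simp
  then have "social_cost n b c s = \<infinity>"
    unfolding social_cost_def sum_Pinfty using assms(2) by (auto intro!: bexI[of _ 0])
  then show ?thesis
    by simp
qed

text \<open>Dropping a channel off a fixed spanning tree keeps the network connected and saves more
  than the other two cost terms can grow. The \<open>n - 1\<close> tree edges remain, each counted
  once for either end that may pay for it.\<close>

lemma nash_channels_le:
  assumes "s \<in> nash_equilibria n b c" "n \<ge> 2" "b \<ge> 0" "c > 0" "c + b < 1 / (real n)\<^sup>2"
  shows "(\<Sum>u<n. card (s u)) \<le> 2 * (n - 1)"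
proof -
  have conn: "Digraph_Component.connected (with_proj (network n s))"
    and strat: "\<And>u. u < n \<Longrightarrow> s u \<subseteq> {..<n} - {u}"
    and nash: "\<And>u t. u < n \<Longrightarrow> t \<in> strategies n u \<Longrightarrow> \<not> cost n b c (s(u := t)) u < cost n b c s u"
    using assms(1) by (auto simp: nash_equilibria_def combinations_def strategies_def PiE_iff)
  have fin: "finite (s u)" if "u < n" for u
    using strat[OF that] finite_subset by blast
  have "0 < n"
    using assms(2) by simp
  obtain p and d :: "nat \<Rightarrow> nat" where
    p: "\<And>v. v < n \<Longrightarrow> v \<noteq> 0 \<Longrightarrow> (p v, v) \<in> parcs (network n s) \<and> d (p v) < d v"
    using connected_obtain_parent[OF conn \<open>0 < n\<close>] by blast
  have on_tree: "(v \<noteq> 0 \<and> p v = u) \<or> (u \<noteq> 0 \<and> p u = v)" if u: "u < n" and v: "v \<in> s u" for u v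
  proof (rule ccontr)
    assume off_tree: "\<not> ?thesis"
    define s' where "s' = s(u := s u - {v})"
    \<comment> \<open>The change affects at most the edge between \<open>u\<close> and
      \<open>v\<close>, which is not a tree edge, so the same \<open>p\<close> and \<open>d\<close>
      serve for \<open>s'\<close>.\<close>
    have "(p w, w) \<in> parcs (network n s')" if "w < n" "w \<noteq> 0" for w
      using p[OF that] off_tree that by (auto simp: s'_def)
    then have "(0, w) \<in> (parcs (network n s'))\<^sup>*" if "w < n" for w
      using p that by (intro rtrancl_via_parent[of "{..<n}" 0 p _ d w]) auto
    then have conn': "Digraph_Component.connected (with_proj (network n s'))"
      by (simp add: connected_network_iff[OF \<open>0 < n\<close>])
    have "cost n b c s' u < ereal (card (s' u) + 1)"
      using cost_connected(2)[OF conn' u] assms by simp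
    also have "card (s' u) + 1 = card (s u)"
      using card_Suc_Diff1[OF fin[OF u] v] by (simp add: s'_def)
    then have "ereal (card (s' u) + 1) = ereal (card (s u))"
      by (metis of_nat_1 of_nat_add)
    also have "\<dots> \<le> cost n b c s u"
      using cost_connected(1)[OF conn u] assms by simp
    finally show False
      using nash[OF u, of "s u - {v}"] strat[OF u] by (auto simp: strategies_def s'_def)
  qed
  have "(\<Sum>u<n. card (s u)) = card (SIGMA u:{..<n}. s u)"
    using fin by (simp add: card_SigmaI)
  \<comment> \<open>Channels, as pairs of payer and partner, are among the two orientations of the
    tree edges.\<close>
  also have "(SIGMA u:{..<n}. s u) \<subseteq> (\<lambda>v. (p v, v)) ` {1..<n} \<union> (\<lambda>v. (v, p v)) ` {1..<n}"
    using on_tree strat by (fastforce simp: image_iff Suc_le_eq)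
  then have "card (SIGMA u:{..<n}. s u) \<le>
      card ((\<lambda>v. (p v, v)) ` {1..<n} \<union> (\<lambda>v. (v, p v)) ` {1..<n})"
    by (intro card_mono) auto
  also have "\<dots> \<le> card ((\<lambda>v. (p v, v)) ` {1..<n}) + card ((\<lambda>v. (v, p v)) ` {1..<n})"
    by (rule card_Un_le)
  also have "\<dots> \<le> card {1..<n} + card {1..<n}"
    by (intro add_mono card_image_le) auto
  finally show ?thesis
    by simp
qed

text \<open>At most \<open>2 * (n - 1)\<close> channels, plus less than 1 per player for the
  remaining terms.\<close>

lemma nash_social_cost_le:
  assumes "s \<in> nash_equilibria n b c" "n \<ge> 2" "b \<ge> 0" "c > 0" "c + b < 1 / (real n)\<^sup>2"
  shows "social_cost n b c s \<le> ereal (3 * n)"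
proof -
  have conn: "Digraph_Component.connected (with_proj (network n s))"
    using assms(1) by (simp add: nash_equilibria_def)
  have "social_cost n b c s \<le> (\<Sum>u<n. ereal (card (s u) + 1))"
    unfolding social_cost_def
    using cost_connected(2)[OF conn] assms by (intro sum_mono less_imp_le) auto
  also have "\<dots> = ereal (real (\<Sum>u<n. card (s u)) + n)"
    by (simp add: sum.distrib)
  also have "\<dots> \<le> ereal (3 * n)"
    using of_nat_mono[OF nash_channels_le[OF assms], where 'a = real] assms(2)
    by (simp add: of_nat_diff)
  finally show ?thesis .
qed

section \<open>The star equilibrium\<close>

text \<open>The restricted abstraction makes the function extensional, as membership in
  \<open>combinations n\<close> demands.\<close>

definition star :: "nat \<Rightarrow> nat \<Rightarrow> nat set" where
  "star n = (\<lambda>u\<in>{..<n}. if u = 0 then {1..<n} else {})"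

text \<open>Leaves pay for nothing, so the centre would cut off any leaf it dropped. A leaf's cost
  is below 1, so opening any channel cannot lower it.\<close>

lemma star_in_nash_equilibria:
  assumes "n \<ge> 2" "b \<ge> 0" "c > 0" "c + b < 1 / (real n)\<^sup>2"
  shows "star n \<in> nash_equilibria n b c"
proof -
  have "0 < n"
    using assms(1) by simp
  have "(0, v) \<in> (parcs (network n (star n)))\<^sup>*" if "v < n" for v
    using that by (cases "v = 0") (auto simp: star_def)
  then have conn: "Digraph_Component.connected (with_proj (network n (star n)))"
    by (simp add: connected_network_iff[OF \<open>0 < n\<close>])
  have comb: "star n \<in> combinations n"
    by (auto simp: star_def combinations_def strategies_def split: if_splits)
  have "\<not> cost n b c ((star n)(u := t)) u < cost n b c (star n) u"
    if u: "u < n" and t: "t \<in> strategies n u" for u t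
  proof (cases "t = star n u")
    case True
    then show ?thesis by simp
  next
    case t_ne: False
    define s' where "s' = (star n)(u := t)"
    have "cost n b c (star n) u \<le> cost n b c s' u"
    proof (cases "Digraph_Component.connected (with_proj (network n s'))")
      case False
      then show ?thesis
        using cost_disconnected u assms(3) by simp
    next
      case True
      \<comment> \<open>If the centre deviates, it leaves out some leaf \<open>v\<close>; nobody
        else opens a channel to \<open>v\<close>, yet connectedness would give \<open>v\<close> a
        parent.\<close>
      have "u \<noteq> 0"
      proof
        assume "u = 0"
        have "t \<subseteq> {1..<n}" "t \<noteq> {1..<n}"
          using t_ne t \<open>0 < n\<close> by (auto simp: \<open>u = 0\<close> star_def strategies_def Suc_le_eq)
        then obtain v where v: "v < n" "v \<noteq> 0" "v \<notin> t"
          by fastforce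
        obtain p and d :: "nat \<Rightarrow> nat" where
          "\<And>v. v < n \<Longrightarrow> v \<noteq> 0 \<Longrightarrow> (p v, v) \<in> parcs (network n s') \<and> d (p v) < d v"
          using connected_obtain_parent[OF True \<open>0 < n\<close>] by blast
        then have "(p v, v) \<in> parcs (network n s')"
          using v by blast
        then show False
          using v by (auto simp: s'_def star_def \<open>u = 0\<close> split: if_splits)
      qed
      then have "star n u = {}"
        using u by (simp add: star_def)
      moreover have "finite t"
        using t finite_subset by (auto simp: strategies_def)
      ultimately have "card (star n u) + 1 \<le> card (s' u)"
        using t_ne by (simp add: s'_def Suc_le_eq card_gt_0_iff)
      then have "ereal (card (star n u) + 1) \<le> ereal (card (s' u))"
        by simp
      then show ?thesis
        using cost_connected(2)[OF conn u assms(2-4)] cost_connected(1)[OF True u assms(2-4)]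
        by (meson less_imp_le order_trans)
    qed
    then show ?thesis
      by (simp add: s'_def not_less)
  qed
  then show ?thesis
    using conn comb by (simp add: nash_equilibria_def)
qed

section \<open>Ratio of the extremal social costs\<close>

lemma price_of_anarchy_le:
  assumes "n \<ge> 2" "b \<ge> 0" "c > 0" "c + b < 1 / (real n)\<^sup>2"
  shows "price_of_anarchy n b c \<le> 6"
proof -
  define M where "M = Max (social_cost n b c ` nash_equilibria n b c)"
  define m where "m = Min (social_cost n b c ` combinations n)"
  have fin: "finite (combinations n)"
    by (auto simp: combinations_def strategies_def intro!: finite_PiE)
  have sub: "nash_equilibria n b c \<subseteq> combinations n"
    by (auto simp: nash_equilibria_def)
  have star: "star n \<in> nash_equilibria n b c"
    by (rule star_in_nash_equilibria[OF assms])
  have "M \<le> ereal (3 * n)"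
    \<comment> \<open>The star makes the set under \<open>Max\<close> nonempty, so that
      \<open>Max\<close> is a genuine maximum.\<close>
    unfolding M_def using star nash_social_cost_le[OF _ assms] finite_subset[OF sub fin]
    by (subst Max_le_iff) auto
  moreover have "ereal (n / 2) \<le> m"
    unfolding m_def using star sub social_cost_ge[OF _ assms] fin
    by (subst Min_ge_iff) auto
  \<comment> \<open>The constant is \<open>3 * n\<close> divided by \<open>n / 2\<close>. The bounds
    exclude \<open>M = \<infinity>\<close> and \<open>m = -\<infinity>\<close>, and a quotient by
    \<open>\<infinity>\<close> is 0.\<close>
  ultimately have "M / m \<le> 6"
    using assms(1) by (cases M; cases m) (auto simp: divide_le_eq)
  then show ?thesis
    by (simp add: price_of_anarchy_def M_def m_def)
qed

theorem theorem9:
  shows "\<exists>C::real. \<forall>(n::nat) (b::real) (c::real).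
           n \<ge> 2 \<longrightarrow> b \<ge> 0 \<longrightarrow> c > 0 \<longrightarrow> c + b < 1 / (real n)^2 \<longrightarrow>
           price_of_anarchy n b c \<le> ereal C"
  using price_of_anarchy_le by (intro exI[of _ 6]) auto

end
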